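(* Let $T$ be a tree (of arbitrary finite or infinite order). Then the inclusion $U(T)\subseteq\mathbf{US}$ holds if and only if $T$ is isomorphic either to a star graph or to a double-star graph.
   Context: $\mathbb{R}^+ = [0,\infty)$. A (simple) graph is a pair $G=(V(G),E(G))$ with $V(G)$ a nonempty set (possibly infinite) and $E(G)$ a set of two-point subsets of $V(G)$. The degree of a vertex $v$ is the cardinality of $\{u \in V(G) : \{u,v\}\in E(G)\}$. Two graphs $G_1,G_2$ are isomorphic if there is a bijection $\Phi\colon V(G_1)\to V(G_2)$ with $\{u,v\}\in E(G_1)\iff\{\Phi(u),\Phi(v)\}\in E(G_2)$ for all $u,v\in V(G_1)$. A path is a finite graph $P$ whose vertices can be numbered without repetition as $v_1,\dots,v_k$, $k\ge 2$, with $E(P)=\{\{v_1,v_2\},\dots,\{v_{k-1},v_k\}\}$; it joins $v_1$ and $v_k$. A cycle is a finite graph with at least three vertices, which can be numbered without repetition as $v_1,\dots,v_n$ so that the edge set is $\{\{v_1,v_2\},\dots,\{v_{n-1},v_n\},\{v_n,v_1\}\}$. A graph is connected if every two distinct vertices are joined by a path in it. A tree is a connected graph without cycles. An ultrametric on a nonempty set $X$ is a function $d\colon X\times X\to\mathbb{R}^+$ that is symmetric, satisfies $d(x,y)=0 \iff x=y$, and satisfies $d(x,y)\le\max\{d(x,z),d(z,y)\}$ for all $x,y,z\in X$. For a tree $T$ and a vertex labeling $l\colon V(T)\to\mathbb{R}^+$, define $d_l\colon V(T)\times V(T)\to\mathbb{R}^+$ by $d_l(u,u)=0$ and, for $u\ne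 v$, $d_l(u,v)=\max_{w\in V(P)} l(w)$, where $P$ is the unique path joining $u$ and $v$ in $T$. The labeling $l$ is non-degenerate if $\max\{l(u),l(v)\}>0$ for every $\{u,v\}\in E(T)$; it is known that $d_l$ is an ultrametric on $V(T)$ if and only if $l$ is non-degenerate. Let $L(T)$ be the set of all non-degenerate labelings of $V(T)$, and $U(T):=\{(V(T),d_l) : l\in L(T)\}$. A star graph is a tree $S$ for which there is a vertex $c\in V(S)$ adjacent to every vertex of $V(S)\setminus\{c\}$, with no other edges. A double-star graph is a tree that contains exactly two distinct vertices whose degrees are greater than one. $\mathbf{US}$ denotes the class of all ultrametric spaces generated by labeled star graphs, i.e. all ultrametric spaces $(X,d)$ for which there exist a star graph $S$ with $V(S)=X$ and a labeling $l\colon V(S)\to\mathbb{R}^+$ such that $d=d_l$. *)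

theory Defs
  imports Complex_Main "HOL-Library.FuncSet"
begin

unbundle cardinal_syntax

text \<open>
  Graphs are pairs of a vertex set and an edge set, of arbitrary cardinality. Labelings and
  metrics are functions on a carrier set; they are taken extensional
  (\<^const>\<open>PiE\<close>, \<^const>\<open>restrict\<close>), so that equality of functions is equality on the carrier.
\<close>

type_synonym 'a graph = "'a set \<times> 'a set set"

abbreviation verts :: "'a graph \<Rightarrow> 'a set" where "verts \<equiv> fst"
abbreviation edges :: "'a graph \<Rightarrow> 'a set set" where "edges \<equiv> snd"

definition simple_graph :: "'a graph \<Rightarrow> bool" where
  "simple_graph G \<longleftrightarrow>
     verts G \<noteq> {} \<and> edges G \<subseteq> {{u, v} |u v. u \<in> verts G \<and> v \<in> verts G \<and> u \<noteq> v}"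

definition subgraph :: "'a graph \<Rightarrow> 'a graph \<Rightarrow> bool" where
  "subgraph H G \<longleftrightarrow> simple_graph H \<and> verts H \<subseteq> verts G \<and> edges H \<subseteq> edges G"

text \<open>A cardinal rather than a natural number, because vertices may have infinitely many
  neighbours (and \<^const>\<open>card\<close> of an infinite set is 0).\<close>

definition degree :: "'a graph \<Rightarrow> 'a \<Rightarrow> 'a rel" where
  "degree G v = |{u \<in> verts G. {u, v} \<in> edges G}|"

definition isomorphic :: "'a graph \<Rightarrow> 'b graph \<Rightarrow> bool" where
  "isomorphic G H \<longleftrightarrow>
     (\<exists>\<Phi>. bij_betw \<Phi> (verts G) (verts H) \<and>
        (\<forall>u \<in> verts G. \<forall>v \<in> verts G. {u, v} \<in> edges G \<longleftrightarrow> {\<Phi> u, \<Phi> v} \<in> edges H))"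

definition path_joining :: "'a \<Rightarrow> 'a \<Rightarrow> 'a graph \<Rightarrow> bool" where
  "path_joining u v P \<longleftrightarrow>
     (\<exists>xs. distinct xs \<and> length xs \<ge> 2 \<and> hd xs = u \<and> last xs = v \<and>
        verts P = set xs \<and>
        edges P = {{xs ! i, xs ! Suc i} |i. Suc i < length xs})"

definition is_cycle :: "'a graph \<Rightarrow> bool" where
  "is_cycle C \<longleftrightarrow>
     (\<exists>xs. distinct xs \<and> length xs \<ge> 3 \<and>
        verts C = set xs \<and>
        edges C = insert {last xs, hd xs} {{xs ! i, xs ! Suc i} |i. Suc i < length xs})"

definition connected_graph :: "'a graph \<Rightarrow> bool" where
  "connected_graph G \<longleftrightarrow>
     (\<forall>u \<in> verts G. \<forall>v \<in> verts G. u \<noteq> v \<longrightarrow> (\<exists>P. path_joining u v P \<and> subgraph P G))"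

definition tree :: "'a graph \<Rightarrow> bool" where
  "tree T \<longleftrightarrow>
     simple_graph T \<and> connected_graph T \<and> \<not> (\<exists>C. is_cycle C \<and> subgraph C T)"

definition star_graph :: "'a graph \<Rightarrow> bool" where
  "star_graph S \<longleftrightarrow>
     tree S \<and> (\<exists>c \<in> verts S. edges S = {{c, v} |v. v \<in> verts S - {c}})"

definition double_star_graph :: "'a graph \<Rightarrow> bool" where
  "double_star_graph S \<longleftrightarrow>
     tree S \<and> card {v \<in> verts S. cone <o degree S v} = 2"

definition ultrametric_on :: "'a set \<Rightarrow> ('a \<times> 'a \<Rightarrow> real) \<Rightarrow> bool" where
  "ultrametric_on X d \<longleftrightarrow>
     X \<noteq> {} \<and> d \<in> X \<times> X \<rightarrow>\<^sub>E {0..} \<and>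
     (\<forall>x \<in> X. \<forall>y \<in> X. d (x, y) = d (y, x)) \<and>
     (\<forall>x \<in> X. \<forall>y \<in> X. d (x, y) = 0 \<longleftrightarrow> x = y) \<and>
     (\<forall>x \<in> X. \<forall>y \<in> X. \<forall>z \<in> X. d (x, y) \<le> max (d (x, z)) (d (z, y)))"

definition labelings :: "'a graph \<Rightarrow> ('a \<Rightarrow> real) set" where
  "labelings T = verts T \<rightarrow>\<^sub>E {0..}"

definition label_dist :: "'a graph \<Rightarrow> ('a \<Rightarrow> real) \<Rightarrow> 'a \<times> 'a \<Rightarrow> real" where
  "label_dist T l =
     restrict
       (\<lambda>(u, v). if u = v then 0
                 else Max (l ` verts (THE P. path_joining u v P \<and> subgraph P T)))
       (verts T \<times> verts T)"

definition nondegenerate :: "'a graph \<Rightarrow> ('a \<Rightarrow> real) \<Rightarrow> bool" where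
  "nondegenerate T l \<longleftrightarrow> (\<forall>u v. {u, v} \<in> edges T \<longrightarrow> max (l u) (l v) > 0)"

definition L :: "'a graph \<Rightarrow> ('a \<Rightarrow> real) set" where
  "L T = {l \<in> labelings T. nondegenerate T l}"

definition U :: "'a graph \<Rightarrow> ('a set \<times> ('a \<times> 'a \<Rightarrow> real)) set" where
  "U T = {(verts T, label_dist T l) |l. l \<in> L T}"

text \<open>The members of the class whose points lie in a given type. Since the star has the point
  set of the space as its vertex set, this loses nothing for comparison with \<^const>\<open>U\<close>.\<close>

definition US :: "('a set \<times> ('a \<times> 'a \<Rightarrow> real)) set" where
  "US = {(X, d). ultrametric_on X d \<and>
           (\<exists>S l. star_graph S \<and> verts S = X \<and> l \<in> labelings S \<and> d = label_dist S l)}"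

end

(* In a space generated by a star with centre z and labels m, the distance of distinct points u, v
   is max (m z) (max (m u) (m v)). If T is a double star with centres a, b and l a <= l b, raising
   the label of each leaf at b to at least l b turns d_l into this form with z = a.
   Conversely, let T contain a path p, a, b, c, q, label b with 2 and all other vertices with 1.
   Then d(p, a) = d(c, q) = 1 would force m z, m a, m c <= 1 in a star, while d(a, c) = 2.
   So T has no path with five vertices; hence any two vertices of degree > 1 are adjacent, as a path
   between them extends at both ends, and since T has no triangle there are at most two of them. *)

theory Submission
  imports Defs
begin

section \<open>Adjacency, and paths as vertex lists\<close>

definition adj :: "'a graph \<Rightarrow> 'a \<Rightarrow> 'a \<Rightarrow> bool" where
  "adj G u v \<longleftrightarrow> {u, v} \<in> edges G"

lemma adj_commute: "adj G u v \<longleftrightarrow> adj G v u"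
  by (simp add: adj_def insert_commute)

lemma adj_verts:
  assumes "simple_graph G" "adj G u v"
  shows "u \<in> verts G" "v \<in> verts G" "u \<noteq> v"
proof -
  from assms obtain a b where "{u, v} = {a, b}" "a \<in> verts G" "b \<in> verts G" "a \<noteq> b"
    unfolding simple_graph_def adj_def by blast
  then show "u \<in> verts G" "v \<in> verts G" "u \<noteq> v"
    by (auto simp: doubleton_eq_iff)
qed

definition vpath :: "'a graph \<Rightarrow> 'a list \<Rightarrow> bool" where
  "vpath G xs \<longleftrightarrow> xs \<noteq> [] \<and> set xs \<subseteq> verts G \<and> distinct xs \<and> successively (adj G) xs"

definition path_graph :: "'a list \<Rightarrow> 'a graph" where
  "path_graph xs = (set xs, {{xs ! i, xs ! Suc i} |i. Suc i < length xs})"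

lemma vpath_rev: "vpath G (rev xs) \<longleftrightarrow> vpath G xs"
  unfolding vpath_def successively_rev by (subst adj_commute) simp

lemma path_joining_iff:
  "path_joining u v P \<longleftrightarrow>
     (\<exists>xs. distinct xs \<and> length xs \<ge> 2 \<and> hd xs = u \<and> last xs = v \<and> P = path_graph xs)"
  unfolding path_joining_def path_graph_def by (auto simp: prod_eq_iff)

text \<open>Translates between paths as graphs and paths as lists. Distinctness keeps consecutive
  entries apart, so \<open>path_graph xs\<close> is simple and only its containment in
  \<open>G\<close> is at stake.\<close>

lemma subgraph_path_graph:
  assumes "distinct xs" "xs \<noteq> []"
  shows "subgraph (path_graph xs) G \<longleftrightarrow> vpath G xs"
proof -
  have "simple_graph (path_graph xs)"
    unfolding simple_graph_def path_graph_def
  proof (intro conjI subsetI)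
    show "verts (set xs, {{xs ! i, xs ! Suc i} |i. Suc i < length xs}) \<noteq> {}"
      using assms by simp
    fix e assume "e \<in> edges (set xs, {{xs ! i, xs ! Suc i} |i. Suc i < length xs})"
    then obtain i where i: "e = {xs ! i, xs ! Suc i}" "Suc i < length xs" by auto
    then have "xs ! i \<noteq> xs ! Suc i" "xs ! i \<in> set xs" "xs ! Suc i \<in> set xs"
      using assms by (auto simp: nth_eq_iff_index_eq)
    with i show "e \<in> {{u, v} |u v.
        u \<in> verts (set xs, {{xs ! i, xs ! Suc i} |i. Suc i < length xs}) \<and>
        v \<in> verts (set xs, {{xs ! i, xs ! Suc i} |i. Suc i < length xs}) \<and> u \<noteq> v}"
      by fastforce
  qed
  then show ?thesis
    using assms unfolding subgraph_def vpath_def successively_conv_nth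
    by (auto simp: path_graph_def adj_def)
qed

section \<open>Existence and uniqueness of paths in trees\<close>

lemma tree_simple: "tree T \<Longrightarrow> simple_graph T"
  by (simp add: tree_def)

lemma tree_vpath_exists:
  assumes "tree T" "u \<in> verts T" "v \<in> verts T"
  obtains xs where "vpath T xs" "hd xs = u" "last xs = v"
proof (cases "u = v")
  case True
  with assms show ?thesis
    by (intro that[of "[u]"]) (auto simp: vpath_def)
next
  case False
  with assms obtain P where "path_joining u v P" "subgraph P T"
    unfolding tree_def connected_graph_def by blast
  then obtain xs where "distinct xs" "length xs \<ge> 2" "hd xs = u" "last xs = v"
    "subgraph (path_graph xs) T"
    unfolding path_joining_iff by blast
  moreover from this have "xs \<noteq> []" by auto
  ultimately show ?thesis
    using that subgraph_path_graph by metis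
qed

text \<open>The closing edge turns the list into a cycle. With only two entries it would be the edge
  of the path itself.\<close>

lemma tree_no_closed_vpath:
  assumes "tree T" "vpath T xs" "length xs \<ge> 3"
  shows "\<not> adj T (last xs) (hd xs)"
proof
  assume adj: "adj T (last xs) (hd xs)"
  let ?C = "(set xs, insert {last xs, hd xs} (edges (path_graph xs)))"
  have ne: "xs \<noteq> []" and d: "distinct xs" using assms by (auto simp: vpath_def)
  have sub: "subgraph (path_graph xs) T"
    using assms(2) ne d by (simp add: subgraph_path_graph)
  have neq: "last xs \<noteq> hd xs" using adj_verts[OF tree_simple[OF assms(1)] adj] by simp
  have "is_cycle ?C"
    unfolding is_cycle_def using d assms(3) by (intro exI[of _ xs]) (simp add: path_graph_def)
  moreover have "subgraph ?C T"
    unfolding subgraph_def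
  proof (intro conjI)
    have "edges (path_graph xs) \<subseteq> {{u, v} |u v. u \<in> set xs \<and> v \<in> set xs \<and> u \<noteq> v}"
      using sub by (simp add: subgraph_def simple_graph_def path_graph_def)
    moreover have "{last xs, hd xs} \<in> {{u, v} |u v. u \<in> set xs \<and> v \<in> set xs \<and> u \<noteq> v}"
      using neq ne by force
    ultimately show "simple_graph ?C"
      using ne by (simp add: simple_graph_def)
    show "verts ?C \<subseteq> verts T" using assms(2) by (simp add: vpath_def)
    show "edges ?C \<subseteq> edges T" using sub adj by (simp add: subgraph_def adj_def)
  qed
  ultimately show False using assms(1) by (auto simp: tree_def)
qed

text \<open>If two paths diverge right after their common start, they close up to a cycle at the first
  vertex where they meet again.\<close>

lemma tree_vpath_unique:
  assumes "tree T" "vpath T xs" "vpath T ys" "hd xs = hd ys" "last xs = last ys"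
  shows "xs = ys"
  using assms(2-)
proof (induction xs arbitrary: ys)
  case Nil
  then show ?case by (simp add: vpath_def)
next
  case (Cons u xs)
  then obtain ys' where ys: "ys = u # ys'" by (cases ys) (auto simp: vpath_def)
  show ?case
  proof (cases "xs = [] \<or> ys' = []")
    \<comment> \<open>If one tail is empty, \<open>u\<close> is also the last vertex of the other
      list, and distinctness empties that tail too.\<close>
    case True
    with Cons.prems ys show ?thesis
      by (auto simp: vpath_def split: if_splits)
  next
    case False
    have vx: "vpath T xs" and ux: "adj T u (hd xs)" "u \<notin> set xs" "u \<in> verts T"
      using Cons.prems False by (auto simp: vpath_def successively_Cons)
    have vy: "vpath T ys'" and uy: "adj T u (hd ys')" "u \<notin> set ys'"
      using Cons.prems False ys by (auto simp: vpath_def successively_Cons)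
    have last: "last xs = last ys'" using Cons.prems False ys by simp
    show ?thesis
    proof (cases "hd xs = hd ys'")
      case True
      then show ?thesis using Cons.IH[OF vx vy] last ys by simp
    next
      case neq: False
      have "\<exists>z \<in> set xs. z \<in> set ys'" using last False by (metis last_in_set)
      then obtain A z B where xs: "xs = A @ z # B" and z: "z \<in> set ys'"
        and A: "\<forall>w \<in> set A. w \<notin> set ys'"
        using split_list_first_prop[of xs "\<lambda>z. z \<in> set ys'"] by blast
      from z obtain C D where ys': "ys' = C @ z # D" by (meson split_list)
      \<comment> \<open>From \<open>u\<close> along \<open>xs\<close> to the first common vertex
        \<open>z\<close>, then back along the other path to \<open>hd ys'\<close>, a neighbour of
        \<open>u\<close>.\<close>
      let ?c = "u # A @ z # rev C"
      have vc: "vpath T ?c"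
        using vx vy ux uy A unfolding xs ys'
        by (auto simp: vpath_def successively_Cons successively_append_iff adj_commute hd_append
            hd_rev last_rev split: if_splits)
      \<comment> \<open>If both were empty, \<open>z\<close> would be the head of both
        tails.\<close>
      have "A \<noteq> [] \<or> C \<noteq> []" using neq xs ys' by auto
      then have "length ?c \<ge> 3" by (cases A; cases C) auto
      moreover have "last ?c = hd ys'" using ys' by (cases C) auto
      ultimately show ?thesis
        using tree_no_closed_vpath[OF assms(1) vc] uy(1) by (simp add: adj_commute)
    qed
  qed
qed

section \<open>Label distances in trees and stars\<close>

text \<open>Uniqueness of paths evaluates the \<open>THE\<close> in \<open>label_dist\<close>;
  \<open>u \<noteq> v\<close> supplies the two vertices that \<open>path_joining\<close> asks
  for.\<close>

lemma label_dist_vpath: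
  assumes "tree T" "vpath T xs" and uv: "hd xs = u" "last xs = v" "u \<noteq> v"
  shows "label_dist T l (u, v) = Max (l ` set xs)"
proof -
  let ?Q = "\<lambda>P. path_joining u v P \<and> subgraph P T"
  have xs: "xs \<noteq> []" "distinct xs" using assms(2) by (auto simp: vpath_def)
  have len: "length xs \<ge> 2" using uv xs by (cases xs rule: list.exhaust; cases "tl xs") auto
  have "(THE P. ?Q P) = path_graph xs"
  proof (rule the_equality)
    show "?Q (path_graph xs)"
      using len xs uv assms(2) by (auto simp: path_joining_iff subgraph_path_graph)
    fix P assume "?Q P"
    then obtain ys where ys: "distinct ys" "length ys \<ge> 2" "hd ys = u" "last ys = v"
      "P = path_graph ys" "subgraph P T"
      unfolding path_joining_iff by blast
    then have "ys \<noteq> []" by auto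
    with ys have "vpath T ys" by (simp add: subgraph_path_graph)
    then show "P = path_graph xs"
      using tree_vpath_unique[OF assms(1) _ assms(2)] ys uv by metis
  qed
  moreover have "u \<in> verts T" "v \<in> verts T"
    using assms(2) uv by (auto simp: vpath_def)
  ultimately show ?thesis
    using uv by (simp add: label_dist_def path_graph_def)
qed

text \<open>Every edge contains \<open>c\<close>, but no vertex lies on three edges of a cycle. This
  is what makes the star constructed later on the vertex set of a given tree a
  \<open>star_graph\<close>.\<close>

lemma star_graph_tree:
  assumes c: "c \<in> verts S" and E: "edges S = {{c, v} |v. v \<in> verts S - {c}}"
  shows "tree S"
proof -
  have simple: "simple_graph S"
    unfolding simple_graph_def E using c by auto
  have adjc: "adj S c v" if "v \<in> verts S" "v \<noteq> c" for v
    using that E by (auto simp: adj_def)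
  have inc: "u = c \<or> v = c" if "adj S u v" for u v
    using that unfolding adj_def E by (auto simp: doubleton_eq_iff)
  have "\<exists>P. path_joining u v P \<and> subgraph P S" if uv: "u \<in> verts S" "v \<in> verts S" "u \<noteq> v" for u v
  proof -
    let ?xs = "if u = c \<or> v = c then [u, v] else [u, c, v]"
    have v: "vpath S ?xs"
      using uv c adjc[of u] adjc[of v] by (auto simp: vpath_def adj_commute)
    have "path_joining u v (path_graph ?xs)"
      unfolding path_joining_iff using uv by (intro exI[of _ ?xs]) auto
    moreover have "subgraph (path_graph ?xs) S"
      using v subgraph_path_graph[of ?xs S] by (simp add: vpath_def)
    ultimately show ?thesis by blast
  qed
  then have "connected_graph S" unfolding connected_graph_def by blast
  moreover have False if "is_cycle C" "subgraph C S" for C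
  proof -
    from that(1) obtain xs where xs: "distinct xs" "length xs \<ge> 3"
      "edges C = insert {last xs, hd xs} {{xs ! i, xs ! Suc i} |i. Suc i < length xs}"
      unfolding is_cycle_def by blast
    then obtain x y z zs where xs': "xs = x # y # z # zs"
      by (metis One_nat_def Suc_1 Suc_le_length_iff numeral_3_eq_3)
    have sub: "edges C \<subseteq> edges S" using that(2) by (simp add: subgraph_def)
    have "{xs ! 0, xs ! Suc 0} \<in> edges C" "{xs ! 1, xs ! Suc 1} \<in> edges C"
      unfolding xs(3) using xs(2) by fastforce+
    then have "adj S x y" "adj S y z" using sub xs' by (auto simp: adj_def)
    moreover have "adj S (last xs) x" using xs(3) sub xs' by (auto simp: adj_def)
    ultimately have "x = c \<or> y = c" "y = c \<or> z = c" "last xs = c \<or> x = c"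
      using inc by blast+
    moreover have "last xs \<noteq> y" using xs(1) xs' by auto
    ultimately show False using xs(1) xs' by auto
  qed
  ultimately show ?thesis using simple unfolding tree_def by blast
qed

text \<open>The path from \<open>u\<close> to \<open>v\<close> is a single edge at \<open>c\<close>
  or passes through \<open>c\<close>, so the label of \<open>c\<close> always enters the
  maximum.\<close>

lemma label_dist_star:
  assumes S: "tree S" and c: "c \<in> verts S" and adjc: "\<And>v. v \<in> verts S \<Longrightarrow> v \<noteq> c \<Longrightarrow> adj S c v"
    and uv: "u \<in> verts S" "v \<in> verts S" "u \<noteq> v"
  shows "label_dist S l (u, v) = max (l c) (max (l u) (l v))"
proof -
  let ?xs = "if u = c \<or> v = c then [u, v] else [u, c, v]"
  have "vpath S ?xs"
    using uv c adjc[of u] adjc[of v] by (auto simp: vpath_def adj_commute)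
  from label_dist_vpath[OF S this, of u v l] show ?thesis
    using uv by (auto simp: max.commute max.left_commute)
qed

section \<open>Vertices of degree greater than one, and dominating edges\<close>

text \<open>Negate both sides: the neighbourhood has cardinality at most one exactly if it injects
  into a singleton, that is, if any two neighbours coincide.\<close>

lemma cone_less_degree_iff:
  assumes "simple_graph G"
  shows "cone <o degree G v \<longleftrightarrow> (\<exists>x y. x \<noteq> y \<and> adj G x v \<and> adj G y v)"
proof -
  let ?N = "{u \<in> verts G. {u, v} \<in> edges G}"
  have "cone <o degree G v \<longleftrightarrow> \<not> ( |?N| \<le>o |{()}| )"
    unfolding degree_def cone_def
    by (simp add: not_ordLeq_iff_ordLess card_of_Well_order)
  also have "\<dots> \<longleftrightarrow> \<not> (\<exists>f. inj_on f ?N \<and> f ` ?N \<subseteq> {()})"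
    by (simp only: card_of_ordLeq)
  also have "\<dots> \<longleftrightarrow> (\<exists>x y. x \<noteq> y \<and> adj G x v \<and> adj G y v)"
    using adj_verts[OF assms] by (auto simp: inj_on_def adj_def)
  finally show ?thesis .
qed

text \<open>The vertices of degree greater than one, described without cardinals.\<close>

definition branching :: "'a graph \<Rightarrow> 'a set" where
  "branching G = {v. \<exists>x y. x \<noteq> y \<and> adj G x v \<and> adj G y v}"

lemma branchingI: "adj G v x \<Longrightarrow> adj G v y \<Longrightarrow> x \<noteq> y \<Longrightarrow> v \<in> branching G"
  unfolding branching_def by (intro CollectI exI[of _ x] exI[of _ y]) (simp add: adj_commute)

lemma double_star_graph_iff:
  assumes "tree T"
  shows "double_star_graph T \<longleftrightarrow> card (branching T) = 2"
proof -
  have "{v \<in> verts T. cone <o degree T v} = branching T"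
    using cone_less_degree_iff[OF tree_simple[OF assms]] adj_verts[OF tree_simple[OF assms]]
    by (auto simp: branching_def)
  then show ?thesis using assms by (simp add: double_star_graph_def)
qed

text \<open>The second vertex of the path from \<open>u\<close> to \<open>v\<close> is either
  \<open>v\<close> itself or an inner vertex, which has two neighbours on the path. Knowing all
  branching vertices thus tells where every other vertex is attached.\<close>

lemma tree_neighbour_cases:
  assumes T: "tree T" and uv: "u \<in> verts T" "v \<in> verts T" "u \<noteq> v"
  shows "adj T u v \<or> (\<exists>w \<in> branching T - {v}. adj T u w)"
proof -
  obtain xs where xs: "vpath T xs" "hd xs = u" "last xs = v"
    using tree_vpath_exists[OF T uv(1,2)] by blast
  then obtain w ys where w: "xs = u # w # ys"
    using uv(3) by (cases xs rule: list.exhaust; cases "tl xs") (auto simp: vpath_def)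
  show ?thesis
  proof (cases ys)
    case Nil
    with xs w show ?thesis by (simp add: vpath_def)
  next
    case (Cons y zs)
    with xs w have "u \<noteq> y" "adj T u w" "adj T w y" "w \<notin> set ys" "last ys = v"
      by (auto simp: vpath_def)
    moreover from this have "w \<noteq> v" using Cons by (metis last_in_set list.distinct(1))
    ultimately show ?thesis
      using branchingI[of T w u y] by (auto simp: adj_commute)
  qed
qed

text \<open>The common shape of stars (\<open>a = b\<close>) and double stars (\<open>a \<noteq> b\<close>), phrased so that it is
  visibly invariant under isomorphism.\<close>

definition edge_dominated :: "'a graph \<Rightarrow> 'a \<Rightarrow> 'a \<Rightarrow> bool" where
  "edge_dominated G a b \<longleftrightarrow> a \<in> verts G \<and> b \<in> verts G \<and> (a = b \<or> adj G a b) \<and>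
     (\<forall>v \<in> verts G - {a, b}. adj G v a \<or> adj G v b)"

lemma edge_dominated_commute: "edge_dominated G a b \<Longrightarrow> edge_dominated G b a"
  by (auto simp: edge_dominated_def adj_commute)

lemma star_graph_edge_dominated:
  assumes "star_graph S"
  shows "\<exists>a. edge_dominated S a a"
  using assms unfolding star_graph_def edge_dominated_def adj_def by (auto simp: insert_commute)

lemma double_star_graph_edge_dominated:
  assumes "double_star_graph S"
  shows "\<exists>a b. edge_dominated S a b"
proof -
  have T: "tree S" using assms by (simp add: double_star_graph_def)
  then have "card (branching S) = 2" using assms double_star_graph_iff by blast
  then obtain a b where ab: "branching S = {a, b}" "a \<noteq> b" by (auto simp: card_2_iff)
  have V: "a \<in> verts S" "b \<in> verts S"
    using ab adj_verts[OF tree_simple[OF T]] unfolding branching_def by blast+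
  \<comment> \<open>Otherwise the branching neighbour of \<open>a\<close> other than
    \<open>b\<close> would be \<open>a\<close> itself.\<close>
  have "adj S a b"
    using tree_neighbour_cases[OF T V ab(2)] adj_verts(3)[OF tree_simple[OF T], of a a] ab by auto
  moreover have "adj S v a \<or> adj S v b" if "v \<in> verts S" "v \<noteq> a" for v
    using tree_neighbour_cases[OF T that(1) V(1) that(2)] ab(1) by auto
  ultimately show ?thesis using V unfolding edge_dominated_def by blast
qed

text \<open>Only vertices and adjacency are pulled back along the isomorphism; paths and degrees
  need no transport.\<close>

lemma isomorphic_edge_dominated:
  assumes "isomorphic T S" "edge_dominated S a b"
  shows "\<exists>a b. edge_dominated T a b"
proof -
  obtain f where f: "bij_betw f (verts T) (verts S)"
    "\<And>u v. u \<in> verts T \<Longrightarrow> v \<in> verts T \<Longrightarrow> adj T u v \<longleftrightarrow> adj S (f u) (f v)"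
    using assms(1) unfolding isomorphic_def adj_def by blast
  have im: "f ` verts T = verts S" and inj: "inj_on f (verts T)"
    using f(1) by (auto simp: bij_betw_def)
  have "a \<in> f ` verts T" "b \<in> f ` verts T"
    using assms(2) im by (simp_all add: edge_dominated_def)
  then obtain x y where xy: "x \<in> verts T" "y \<in> verts T" "f x = a" "f y = b"
    by blast
  have "adj T v x \<or> adj T v y" if "v \<in> verts T - {x, y}" for v
  proof -
    have "f v \<in> verts S - {a, b}" using that xy inj im by (auto simp: inj_on_def)
    then show ?thesis using assms(2) f(2) that xy unfolding edge_dominated_def by auto
  qed
  moreover have "x = y \<or> adj T x y"
    using assms(2) f(2) xy inj unfolding edge_dominated_def inj_on_def by auto
  ultimately show ?thesis using xy unfolding edge_dominated_def by blast
qed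

section \<open>Sufficiency: relabeling as a star\<close>

text \<open>A path to a vertex not near \<open>a\<close> (neither \<open>a\<close> nor adjacent to
  it) uses \<open>b\<close>, unless it is trivial; the raised label \<open>m\<close> of that vertex
  records \<open>l b\<close>. Where the path avoids \<open>a\<close>, the extra term
  \<open>m a = l a\<close> is absorbed by \<open>l b\<close>.\<close>

lemma label_dist_edge_dominated:
  assumes T: "tree T" and D: "edge_dominated T a b" and le: "l a \<le> l b"
    and m: "m = (\<lambda>x. if x = a \<or> adj T x a then l x else max (l x) (l b))"
    and uv: "u \<in> verts T" "v \<in> verts T" "u \<noteq> v"
  shows "label_dist T l (u, v) = max (m a) (max (m u) (m v))"
proof -
  have sym: "label_dist T l (x, y) = label_dist T l (y, x)"
    if xy: "x \<in> verts T" "y \<in> verts T" "x \<noteq> y" for x y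
  proof -
    obtain xs where xs: "vpath T xs" "hd xs = x" "last xs = y"
      using tree_vpath_exists[OF T xy(1,2)] by blast
    have "vpath T (rev xs)" using xs vpath_rev by blast
    then show ?thesis
      using label_dist_vpath[OF T xs, of l] label_dist_vpath[OF T, of "rev xs" y x l] xs xy
      by (simp add: hd_rev last_rev)
  qed
  have a: "a \<in> verts T" and b: "b \<in> verts T" and ab: "a \<noteq> b \<Longrightarrow> adj T a b"
    and dom: "\<And>v. v \<in> verts T \<Longrightarrow> v \<noteq> a \<Longrightarrow> \<not> adj T v a \<Longrightarrow> v \<noteq> b \<and> adj T v b \<and> a \<noteq> b"
    using D unfolding edge_dominated_def by (auto simp: adj_commute)
  have near: "label_dist T l (x, y) = max (m a) (max (m x) (m y))"
    if x: "x \<in> verts T" "x = a \<or> adj T x a" and y: "y \<in> verts T" "x \<noteq> y" for x y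
  proof -
    \<comment> \<open>The actual tree path: within the neighbourhood of \<open>a\<close> it runs
      through \<open>a\<close>, and to a vertex hanging at \<open>b\<close> it ends in the edge from
      \<open>b\<close>.\<close>
    let ?xs = "if y = a \<or> adj T y a then (if x = a \<or> y = a then [x, y] else [x, a, y])
               else if x = a then [a, b, y] else if x = b then [b, y] else [x, a, b, y]"
    have v: "vpath T ?xs"
      using x y a b ab dom[of y] by (auto simp: vpath_def adj_commute)
    show ?thesis
      using label_dist_vpath[OF T v, of x y l] x y le dom[of y]
      by (auto simp: m max_def)
  qed
  consider "u = a \<or> adj T u a" | "v = a \<or> adj T v a"
    | "u \<noteq> a" "\<not> adj T u a" "v \<noteq> a" "\<not> adj T v a" by blast
  then show ?thesis
  proof cases
    case 1
    then show ?thesis using near uv by blast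
  next
    case 2
    then show ?thesis using near[of v u] sym[of u v] uv by (simp add: max.commute)
  next
    case 3
    \<comment> \<open>Both vertices hang at \<open>b\<close>, so their path misses
      \<open>a\<close>.\<close>
    have "vpath T [u, b, v]"
      using 3 uv b dom[of u] dom[of v] by (auto simp: vpath_def adj_commute)
    from label_dist_vpath[OF T this, of u v l] show ?thesis
      using 3 uv le by (auto simp: m max_def)
  qed
qed

text \<open>Take the star on \<open>verts T\<close> with centre \<open>a\<close> and labels
  \<open>m\<close>. Its distance formula yields the ultrametric inequality, and non-degeneracy of
  \<open>l\<close> yields positivity.\<close>

lemma edge_dominated_in_US:
  assumes T: "tree T" and D: "edge_dominated T a b" and le: "l a \<le> l b" and l: "l \<in> L T"
  shows "(verts T, label_dist T l) \<in> US"
proof -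
  define m where "m = (\<lambda>x. if x = a \<or> adj T x a then l x else max (l x) (l b))"
  define S where "S = (verts T, {{a, v} |v. v \<in> verts T - {a}})"
  let ?m = "restrict m (verts T)" and ?d = "label_dist T l"
  have a: "a \<in> verts T" using D by (simp add: edge_dominated_def)
  have S: "tree S" using star_graph_tree[of a S] a by (simp add: S_def)
  have star: "star_graph S" using S a by (auto simp: star_graph_def S_def)
  have d: "?d (u, v) = max (m a) (max (m u) (m v))"
    if "u \<in> verts T" "v \<in> verts T" "u \<noteq> v" for u v
    using label_dist_edge_dominated[OF T D le m_def that] .
  have d0: "?d (u, u) = 0" if "u \<in> verts T" for u
    using that by (simp add: label_dist_def)
  have "label_dist S ?m (u, v) = ?d (u, v)" if uv: "u \<in> verts T" "v \<in> verts T" for u v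
  proof (cases "u = v")
    case True
    then show ?thesis using uv by (simp add: label_dist_def S_def)
  next
    case False
    have "label_dist S ?m (u, v) = max (?m a) (max (?m u) (?m v))"
      by (rule label_dist_star[OF S]) (use uv a False in \<open>auto simp: S_def adj_def\<close>)
    then show ?thesis using uv a False by (simp add: d)
  qed
  then have eq: "?d = label_dist S ?m"
    by (intro ext) (auto simp: label_dist_def S_def restrict_def)
  have l0: "l x \<ge> 0" if "x \<in> verts T" for x
    using l that by (auto simp: L_def labelings_def)
  have m0: "m x \<ge> 0" if "x \<in> verts T" for x
    using l0[OF that] by (auto simp: m_def)
  have nd: "max (l x) (l y) > 0" if "adj T x y" for x y
    using l that by (auto simp: L_def nondegenerate_def adj_def)
  \<comment> \<open>A neighbour \<open>x\<close> of \<open>a\<close> is covered by the edge between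
    \<open>x\<close> and \<open>a\<close>; for the remaining vertices \<open>m x\<close> is at least
    \<open>l b\<close>, and the edge between \<open>a\<close> and \<open>b\<close> decides.\<close>
  have pos: "max (m a) (m x) > 0" if "x \<in> verts T" "x \<noteq> a" for x
    using that D nd[of a b] nd[of x a]
    by (fastforce simp: m_def edge_dominated_def less_max_iff_disj)
  have dpos: "?d (x, y) > 0" if "x \<in> verts T" "y \<in> verts T" "x \<noteq> y" for x y
    using pos[of x] pos[of y] d[OF that] that by (auto simp: less_max_iff_disj)
  have "ultrametric_on (verts T) ?d"
    unfolding ultrametric_on_def
  proof (intro conjI ballI)
    show "verts T \<noteq> {}" using a by auto
    show "?d \<in> verts T \<times> verts T \<rightarrow>\<^sub>E {0..}"
    proof (rule PiE_I)
      fix p assume "p \<in> verts T \<times> verts T"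
      then show "?d p \<in> {0..}" using dpos d0 by (cases p) (metis SigmaE2 atLeast_iff less_imp_le order_refl)
    qed (auto simp: label_dist_def)
    fix x y assume xy: "x \<in> verts T" "y \<in> verts T"
    show "?d (x, y) = ?d (y, x)"
      using xy d by (cases "x = y") (auto simp: max.commute)
    show "?d (x, y) = 0 \<longleftrightarrow> x = y"
      using xy dpos[of x y] d0 by (metis less_irrefl)
    fix z assume z: "z \<in> verts T"
    show "?d (x, y) \<le> max (?d (x, z)) (?d (z, y))"
    proof (cases "x = y \<or> z = x \<or> z = y")
      case True
      then show ?thesis
        using xy z dpos d0 by (metis less_imp_le max.cobounded1 max.cobounded2 max.coboundedI1 order_refl)
    next
      case False
      then show ?thesis using xy z d by (auto simp: le_max_iff_disj)
    qed
  qed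
  moreover have "?m \<in> labelings S"
    using m0 by (auto simp: labelings_def S_def)
  ultimately show ?thesis
    unfolding US_def using star eq by (auto simp: S_def)
qed

section \<open>Necessity: paths have at most four vertices\<close>

lemma U_subset_US_no_long_vpath:
  assumes T: "tree T" and sub: "U T \<subseteq> US" and path: "vpath T xs"
  shows "length xs < 5"
proof (rule ccontr)
  assume "\<not> length xs < 5"
  then obtain p a b c q rest where xs: "xs = p # a # b # c # q # rest"
    by (auto simp: not_less numeral_eq_Suc Suc_le_length_iff)
  \<comment> \<open>All labels are positive, hence non-degenerate; the large one sits at the middle
    vertex, on the path from \<open>a\<close> to \<open>c\<close> but on neither outer edge.\<close>
  define l where "l = restrict (\<lambda>x. if x = b then 2 else 1 :: real) (verts T)"
  have V: "{p, a, b, c, q} \<subseteq> verts T" using path xs by (simp add: vpath_def)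
  have dist: "distinct [p, a, b, c, q]" using path xs by auto (auto simp: vpath_def)
  have "nondegenerate T l"
    using adj_verts[OF tree_simple[OF T]] by (auto simp: nondegenerate_def l_def less_max_iff_disj adj_def)
  then have "l \<in> L T" by (auto simp: L_def labelings_def l_def)
  then have "(verts T, label_dist T l) \<in> US" using sub by (auto simp: U_def)
  then obtain S m where S: "star_graph S" "verts S = verts T" "label_dist T l = label_dist S m"
    by (auto simp: US_def)
  then obtain z where z: "tree S" "z \<in> verts S" "edges S = {{z, v} |v. v \<in> verts S - {z}}"
    by (auto simp: star_graph_def)
  have star: "label_dist T l (u, v) = max (m z) (max (m u) (m v))"
    if "u \<in> verts T" "v \<in> verts T" "u \<noteq> v" for u v
    unfolding S(3) by (rule label_dist_star[OF z(1,2)]) (use that S(2) z(3) in \<open>auto simp: adj_def\<close>)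
  have "vpath T [p, a]" "vpath T [c, q]" "vpath T [a, b, c]"
    using path xs by (auto simp: vpath_def)
  then have "label_dist T l (p, a) = 1" "label_dist T l (c, q) = 1" "label_dist T l (a, c) = 2"
    using label_dist_vpath[OF T, of "[p, a]" p a l] label_dist_vpath[OF T, of "[c, q]" c q l]
      label_dist_vpath[OF T, of "[a, b, c]" a c l] V dist by (auto simp: l_def)
  then show False using star[of p a] star[of c q] star[of a c] V dist by auto
qed

text \<open>If \<open>p\<close> recurred later, the stretch from \<open>u\<close> to
  \<open>p\<close> and the edge \<open>[u, p]\<close> would be two paths with the same ends;
  uniqueness then forces \<open>p = w\<close>.\<close>

lemma tree_vpath_Cons:
  assumes T: "tree T" and path: "vpath T (u # w # xs)" and p: "adj T p u" "p \<noteq> w"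
  shows "vpath T (p # u # w # xs)"
proof -
  have pu: "p \<in> verts T" "p \<noteq> u" using adj_verts[OF tree_simple[OF T] p(1)] by auto
  have "p \<notin> set (w # xs)"
  proof
    assume "p \<in> set (w # xs)"
    then obtain A B where AB: "w # xs = A @ p # B" by (meson split_list)
    then have "vpath T ((u # A @ [p]) @ B)" using path by simp
    then have "vpath T (u # A @ [p])"
      unfolding vpath_def successively_append_iff by auto
    moreover have "vpath T [u, p]" using path p pu by (auto simp: vpath_def adj_commute)
    ultimately have "u # A @ [p] = [u, p]" by (rule tree_vpath_unique[OF T]) auto
    then show False using AB p(2) by auto
  qed
  then show ?thesis using path p pu by (auto simp: vpath_def)
qed

lemma branching_adj:
  assumes T: "tree T" and short: "\<And>xs. vpath T xs \<Longrightarrow> length xs < 5"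
    and uv: "u \<in> branching T" "v \<in> branching T" "u \<noteq> v"
  shows "adj T u v"
proof -
  have "u \<in> verts T" "v \<in> verts T"
    using uv adj_verts[OF tree_simple[OF T]] unfolding branching_def by blast+
  then obtain xs where xs: "vpath T xs" "hd xs = u" "last xs = v"
    using tree_vpath_exists[OF T] by metis
  then obtain w ys where w: "xs = u # w # ys"
    using uv(3) by (cases xs rule: list.exhaust; cases "tl xs") (auto simp: vpath_def)
  obtain p where p: "adj T p u" "p \<noteq> w" using uv(1) unfolding branching_def by blast
  have path: "vpath T (p # xs)" using tree_vpath_Cons[OF T] xs(1) p unfolding w by blast
  \<comment> \<open>Reversing the list brings the end \<open>v\<close> to the front, where the
    extension lemma applies; \<open>w'\<close> is the vertex before \<open>v\<close> on the
    path.\<close>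
  have "Suc (Suc 0) \<le> length (rev (p # xs))" using w by simp
  then obtain v' w' zs where "rev (p # xs) = v' # w' # zs" by (auto simp only: Suc_le_length_iff)
  moreover have "hd (rev (p # xs)) = v" using xs(3) w by (simp only: hd_rev) simp
  ultimately have w': "rev (p # xs) = v # w' # zs" by simp
  obtain q where q: "adj T q v" "q \<noteq> w'" using uv(2) unfolding branching_def by blast
  have "vpath T (q # rev (p # xs))"
    using tree_vpath_Cons[OF T _ q] path unfolding w' vpath_rev[symmetric, of T "p # xs"] by simp
  \<comment> \<open>The extended path has \<open>4 + length ys\<close> vertices, so \<open>u\<close>
    and \<open>v\<close> were already consecutive.\<close>
  then have "ys = []" using short[of "q # rev (p # xs)"] w by simp
  then show ?thesis using xs w by (simp add: vpath_def)
qed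

lemma star_or_double_star:
  assumes T: "tree T" and short: "\<And>xs. vpath T xs \<Longrightarrow> length xs < 5"
  shows "star_graph T \<or> double_star_graph T"
\<comment> \<open>The first case includes trees without branching vertices, where any vertex serves
  as centre.\<close>
proof (cases "\<exists>c \<in> verts T. branching T \<subseteq> {c}")
  case True
  then obtain c where c: "c \<in> verts T" "branching T \<subseteq> {c}" by blast
  have adjc: "adj T c v" if "v \<in> verts T" "v \<noteq> c" for v
    using tree_neighbour_cases[OF T that(1) c(1) that(2)] c(2) by (auto simp: adj_commute)
  have "edges T = {{c, v} |v. v \<in> verts T - {c}}"
  proof (intro equalityI subsetI)
    fix e assume e: "e \<in> edges T"
    then obtain u v where uv: "e = {u, v}" "u \<in> verts T" "v \<in> verts T" "u \<noteq> v"
      using tree_simple[OF T] unfolding simple_graph_def by blast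
    \<comment> \<open>An edge avoiding \<open>c\<close> would give \<open>u\<close> the two
      neighbours \<open>c\<close> and \<open>v\<close>, making it a second branching vertex.\<close>
    have "u = c \<or> v = c"
    proof (rule ccontr)
      assume "\<not> (u = c \<or> v = c)"
      then have "adj T u c" "adj T u v"
        using adjc[OF uv(2)] e uv(1) by (auto simp: adj_def insert_commute)
      then have "u \<in> branching T"
        using \<open>\<not> (u = c \<or> v = c)\<close> by (auto intro: branchingI)
      with \<open>\<not> (u = c \<or> v = c)\<close> c(2) show False by auto
    qed
    with uv show "e \<in> {{c, v} |v. v \<in> verts T - {c}}" by (auto simp: insert_commute)
  qed (use adjc in \<open>auto simp: adj_def\<close>)
  then show ?thesis using T c by (auto simp: star_graph_def)
next
  case False
  have bV: "branching T \<subseteq> verts T"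
    using adj_verts[OF tree_simple[OF T]] unfolding branching_def by blast
  have "verts T \<noteq> {}" using tree_simple[OF T] by (simp add: simple_graph_def)
  with False bV obtain a b where ab: "a \<in> branching T" "b \<in> branching T" "a \<noteq> b" by blast
  have "x \<in> {a, b}" if x: "x \<in> branching T" for x
  proof (rule ccontr)
    assume "x \<notin> {a, b}"
    then have "adj T a x" "adj T x b" "adj T a b" "x \<noteq> a" "x \<noteq> b"
      using branching_adj[OF T short] ab x by auto
    \<comment> \<open>A third branching vertex would complete a triangle, seen here as two paths
      from \<open>a\<close> to \<open>b\<close>.\<close>
    then have "vpath T [a, x, b]" "vpath T [a, b]"
      using ab x bV by (auto simp: vpath_def)
    then have "[a, x, b] = [a, b]" by (rule tree_vpath_unique[OF T]) auto
    then show False by simp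
  qed
  then have "branching T = {a, b}" using ab by blast
  then show ?thesis using ab(3) double_star_graph_iff[OF T] by simp
qed

theorem corollary3p5:
  fixes T :: "'a graph"
  assumes "tree T"
  shows "U T \<subseteq> US \<longleftrightarrow>
    (\<exists>S :: 'a graph. (star_graph S \<or> double_star_graph S) \<and> isomorphic T S)"
proof
  assume "U T \<subseteq> US"
  then have "star_graph T \<or> double_star_graph T"
    using star_or_double_star U_subset_US_no_long_vpath assms by blast
  moreover have "isomorphic T T"
    unfolding isomorphic_def by (intro exI[of _ id]) auto
  ultimately show "\<exists>S :: 'a graph. (star_graph S \<or> double_star_graph S) \<and> isomorphic T S"
    by blast
next
  assume "\<exists>S :: 'a graph. (star_graph S \<or> double_star_graph S) \<and> isomorphic T S"
  then obtain a b where D: "edge_dominated T a b"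
    using star_graph_edge_dominated double_star_graph_edge_dominated isomorphic_edge_dominated
    by metis
  \<comment> \<open>The two ends of the dominating edge play symmetric roles, so the one with the
    larger label may be taken as \<open>b\<close>.\<close>
  have "(verts T, label_dist T l) \<in> US" if "l \<in> L T" for l
    using edge_dominated_in_US[OF assms D _ that] that
      edge_dominated_in_US[OF assms edge_dominated_commute[OF D] _ that] by linarith
  then show "U T \<subseteq> US" unfolding U_def by blast
qed

end
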